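(* Let $\pi:P\to Q$ be a cylindrical projection of finite posets and let $c_Q:Q\to\mathbb R^d$ be an order-embedding cubic realization of $Q$. Then the order-embedding cubic realizations $c_P:P\to\mathbb R^{d+1}$ compatible with $c_Q$ and $\pi$ are in bijective correspondence with the functions $h:V(\widehat R(\pi))\to\mathbb R$ on the vertex set of the augmented pre-Reeb graph $\widehat R(\pi)$ that are strictly increasing along edges (i.e. $h([v])<h([w])$ for every edge $[v]\to[w]$ of $\widehat R(\pi)$), the correspondence being $c_P(x)=(c_Q(\pi(x)),h([x]))$. In particular, an order-embedding cubic realization $c_P:P\to\mathbb R^{d+1}$ compatible with $c_Q$ and $\pi$ exists if and only if $\widehat R(\pi)$ is acyclic.
   Context: All posets are finite. For a poset, $x\to y$ denotes a cover relation ($x<y$ with nothing strictly between). A cubic realization of a poset $P$ is an injective map $c:P\to\mathbb R^d$ (an embedding of its Hasse diagram) such that for every cover $x\to y$ in $P$ the points $c(x),c(y)$ differ in exactly one coordinate, and in that coordinate $c(x)$ is smaller than $c(y)$. It is order-embedding if $x\le y\iff c(x)\le c(y)$ coordinatewise. A map $\pi:P\to Q$ of posets is a cylindrical projection if: (1) for every cover $v\to w$ in $P$, either $\pi(v)=\pi(w)$ or $\pi(v)\to\pi(w)$ is a cover in $Q$; (2) for every $q\in Q$ the fiber $\pi^{-1}(q)\subset P$ (with the induced order) is a total order with at least 2 elements; (3) writing $b(q)$ and $t(q)$ for the minimal and maximal elements of $\pi^{-1}(q)$, for every cover $q\to q'$ in $Q$ the relations $b(q)\to b(q')$ and $t(q)\to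 t(q')$ are covers in $P$. A cubic realization $c_P:P\to\mathbb R^{d+1}$ is compatible with $c_Q:Q\to\mathbb R^d$ and $\pi$ if $c_P(x)=(c_Q(\pi(x)),h(x))$ for some function $h:P\to\mathbb R$. A cover $v\to w$ in $P$ is horizontal if $\pi(v)\to\pi(w)$ is a cover in $Q$, and vertical if $\pi(v)=\pi(w)$. Let $\sim_h$ be the equivalence relation on $P$ generated by $v\sim_h w$ for horizontal covers $v\to w$; $[v]$ denotes the class of $v$. The pre-Reeb graph $R(\pi)$ is the directed graph whose vertices are the $\sim_h$-classes, with an edge $[v]\to[w]$ whenever there are $v'\in[v]$, $w'\in[w]$ such that $v'\to w'$ is a vertical cover in $P$. The augmented pre-Reeb graph $\widehat R(\pi)$ is obtained from $R(\pi)$ by adding an auxiliary edge $[v]\to[w]$ whenever there are $v'\in[v]$, $w'\in[w]$ such that $\pi(w')<\pi(v')$ in $Q$ and $v',w'$ are incomparable in $P$. Loops are possible a priori; acyclic means having no directed cycles, including loops. *)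

theory Defs
  imports "Jordan_Normal_Form.Matrix" "HOL-Library.FuncSet"
begin

text \<open>
  A finite poset is a finite subset \<open>P\<close> of a partially ordered type with the induced order; taking
  subsets rather than finite types keeps the empty poset. Points of \<open>d\<close>-dimensional real space are
  elements of \<^term>\<open>carrier_vec d :: real vec set\<close>, so that \<open>d\<close> is an ordinary number
  (possibly 0); the order \<open>\<le>\<close> on vectors is the coordinatewise one.
\<close>

definition covers :: "'a::order set \<Rightarrow> 'a \<Rightarrow> 'a \<Rightarrow> bool" where
  "covers P x y \<longleftrightarrow> x \<in> P \<and> y \<in> P \<and> x < y \<and> \<not> (\<exists>z\<in>P. x < z \<and> z < y)"

definition cubic_realization :: "'a::order set \<Rightarrow> nat \<Rightarrow> ('a \<Rightarrow> real vec) \<Rightarrow> bool" where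
  "cubic_realization P d c \<longleftrightarrow>
     c \<in> P \<rightarrow> carrier_vec d \<and> inj_on c P \<and>
     (\<forall>x y. covers P x y \<longrightarrow>
        (\<exists>i<d. c x $ i < c y $ i \<and> (\<forall>j<d. j \<noteq> i \<longrightarrow> c x $ j = c y $ j)))"

definition order_embedding_on :: "'a::order set \<Rightarrow> ('a \<Rightarrow> 'b::order) \<Rightarrow> bool" where
  "order_embedding_on P c \<longleftrightarrow> (\<forall>x\<in>P. \<forall>y\<in>P. x \<le> y \<longleftrightarrow> c x \<le> c y)"

definition fiber :: "'a set \<Rightarrow> ('a \<Rightarrow> 'b) \<Rightarrow> 'b \<Rightarrow> 'a set" where
  "fiber P \<pi> q = {x \<in> P. \<pi> x = q}"

definition fiber_bot :: "'a::order set \<Rightarrow> ('a \<Rightarrow> 'b) \<Rightarrow> 'b \<Rightarrow> 'a" where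
  "fiber_bot P \<pi> q = (LEAST x. x \<in> fiber P \<pi> q)"

definition fiber_top :: "'a::order set \<Rightarrow> ('a \<Rightarrow> 'b) \<Rightarrow> 'b \<Rightarrow> 'a" where
  "fiber_top P \<pi> q = (GREATEST x. x \<in> fiber P \<pi> q)"

text \<open>
  On finite posets the first condition on covers already makes \<open>\<pi>\<close> order-preserving.
\<close>

definition cylindrical_projection :: "'p::order set \<Rightarrow> 'q::order set \<Rightarrow> ('p \<Rightarrow> 'q) \<Rightarrow> bool" where
  "cylindrical_projection P Q \<pi> \<longleftrightarrow>
     \<pi> \<in> P \<rightarrow> Q \<and>
     (\<forall>v w. covers P v w \<longrightarrow> \<pi> v = \<pi> w \<or> covers Q (\<pi> v) (\<pi> w)) \<and>
     (\<forall>q\<in>Q. (\<forall>x\<in>fiber P \<pi> q. \<forall>y\<in>fiber P \<pi> q. x \<le> y \<or> y \<le> x) \<and> 2 \<le> card (fiber P \<pi> q)) \<and>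
     (\<forall>q q'. covers Q q q' \<longrightarrow>
        covers P (fiber_bot P \<pi> q) (fiber_bot P \<pi> q') \<and>
        covers P (fiber_top P \<pi> q) (fiber_top P \<pi> q'))"

definition add_coord :: "real vec \<Rightarrow> real \<Rightarrow> real vec" where
  "add_coord u a = u @\<^sub>v vec 1 (\<lambda>_. a)"

definition compatible :: "'p set \<Rightarrow> ('p \<Rightarrow> 'q) \<Rightarrow> ('q \<Rightarrow> real vec) \<Rightarrow> ('p \<Rightarrow> real vec) \<Rightarrow> bool" where
  "compatible P \<pi> c\<^sub>Q c\<^sub>P \<longleftrightarrow> (\<exists>h :: 'p \<Rightarrow> real. \<forall>x\<in>P. c\<^sub>P x = add_coord (c\<^sub>Q (\<pi> x)) (h x))"

definition horizontal_cover :: "'p::order set \<Rightarrow> 'q::order set \<Rightarrow> ('p \<Rightarrow> 'q) \<Rightarrow> 'p \<Rightarrow> 'p \<Rightarrow> bool" where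
  "horizontal_cover P Q \<pi> v w \<longleftrightarrow> covers P v w \<and> covers Q (\<pi> v) (\<pi> w)"

definition vertical_cover :: "'p::order set \<Rightarrow> ('p \<Rightarrow> 'q) \<Rightarrow> 'p \<Rightarrow> 'p \<Rightarrow> bool" where
  "vertical_cover P \<pi> v w \<longleftrightarrow> covers P v w \<and> \<pi> v = \<pi> w"

definition hor_rel :: "'p::order set \<Rightarrow> 'q::order set \<Rightarrow> ('p \<Rightarrow> 'q) \<Rightarrow> ('p \<times> 'p) set" where
  "hor_rel P Q \<pi> = {(v, w). v \<in> P \<and> w \<in> P \<and> equivclp (horizontal_cover P Q \<pi>) v w}"

definition hor_class :: "'p::order set \<Rightarrow> 'q::order set \<Rightarrow> ('p \<Rightarrow> 'q) \<Rightarrow> 'p \<Rightarrow> 'p set" where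
  "hor_class P Q \<pi> v = hor_rel P Q \<pi> `` {v}"

text \<open>
  Both graphs have the same vertices, the classes of \<open>hor_rel\<close>. Their edges are given as a set of
  pairs, since parallel edges play no role.
\<close>

definition reeb_vertices :: "'p::order set \<Rightarrow> 'q::order set \<Rightarrow> ('p \<Rightarrow> 'q) \<Rightarrow> 'p set set" where
  "reeb_vertices P Q \<pi> = P // hor_rel P Q \<pi>"

definition pre_reeb_edges ::
  "'p::order set \<Rightarrow> 'q::order set \<Rightarrow> ('p \<Rightarrow> 'q) \<Rightarrow> ('p set \<times> 'p set) set" where
  "pre_reeb_edges P Q \<pi> =
     {(V, W). V \<in> reeb_vertices P Q \<pi> \<and> W \<in> reeb_vertices P Q \<pi> \<and>
        (\<exists>v'\<in>V. \<exists>w'\<in>W. vertical_cover P \<pi> v' w')}"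

definition aux_reeb_edges ::
  "'p::order set \<Rightarrow> 'q::order set \<Rightarrow> ('p \<Rightarrow> 'q) \<Rightarrow> ('p set \<times> 'p set) set" where
  "aux_reeb_edges P Q \<pi> =
     {(V, W). V \<in> reeb_vertices P Q \<pi> \<and> W \<in> reeb_vertices P Q \<pi> \<and>
        (\<exists>v'\<in>V. \<exists>w'\<in>W. \<pi> w' < \<pi> v' \<and> \<not> v' \<le> w' \<and> \<not> w' \<le> v')}"

definition aug_reeb_edges ::
  "'p::order set \<Rightarrow> 'q::order set \<Rightarrow> ('p \<Rightarrow> 'q) \<Rightarrow> ('p set \<times> 'p set) set" where
  "aug_reeb_edges P Q \<pi> = pre_reeb_edges P Q \<pi> \<union> aux_reeb_edges P Q \<pi>"

text \<open>
  The extensional function spaces \<open>\<rightarrow>\<^sub>E\<close> make functions on the vertex set, respectively on \<open>P\<close>,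
  correspond to unique HOL functions; without them no bijection could hold.
\<close>

definition increasing_labelings ::
  "'p::order set \<Rightarrow> 'q::order set \<Rightarrow> ('p \<Rightarrow> 'q) \<Rightarrow> ('p set \<Rightarrow> real) set" where
  "increasing_labelings P Q \<pi> =
     {h \<in> reeb_vertices P Q \<pi> \<rightarrow>\<^sub>E UNIV. \<forall>(V, W) \<in> aug_reeb_edges P Q \<pi>. h V < h W}"

definition compatible_oe_realizations ::
  "'p::order set \<Rightarrow> nat \<Rightarrow> ('p \<Rightarrow> 'q) \<Rightarrow> ('q \<Rightarrow> real vec) \<Rightarrow> ('p \<Rightarrow> real vec) set" where
  "compatible_oe_realizations P d \<pi> c\<^sub>Q =
     {c \<in> P \<rightarrow>\<^sub>E carrier_vec (d + 1).
        cubic_realization P (d + 1) c \<and> order_embedding_on P c \<and> compatible P \<pi> c\<^sub>Q c}"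

end

theory Submission
  imports Defs
begin

text \<open>
  Fix a height function \<open>h\<close> on \<open>P\<close> and consider the map \<open>x \<mapsto> (c\<^sub>Q (\<pi> x), h x)\<close>. It is an
  order-embedding cubic realization iff \<open>h\<close> satisfies three local conditions: it is constant along
  horizontal covers, increases along vertical covers, and \<open>h v < h w\<close> whenever \<open>v\<close> and \<open>w\<close> are
  incomparable and \<open>\<pi> w < \<pi> v\<close> (\<open>realization_iff_admissible_height\<close>).

  The first two conditions say exactly that each cover moves a single coordinate: a horizontal
  cover already moves one coordinate of \<open>c\<^sub>Q\<close>, so none may be left over for \<open>h\<close>, while a vertical
  cover moves no coordinate of \<open>c\<^sub>Q\<close>. They also make the map monotone, every relation of \<open>P\<close> being
  a chain of covers. The third condition is what is needed to reflect the order. Suppose that the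
  image of \<open>x\<close> lies below that of \<open>y\<close>; then \<open>\<pi> x \<le> \<pi> y\<close> because \<open>c\<^sub>Q\<close> is an order embedding. If
  \<open>\<pi> x = \<pi> y\<close>, the points are comparable, the fiber being a chain, and heights increase strictly
  along a fiber. If \<open>\<pi> x < \<pi> y\<close>, then \<open>y \<le> x\<close> is impossible since \<open>\<pi>\<close> is monotone, and
  incomparability would give \<open>h y < h x\<close>. Conversely, incomparable points \<open>v\<close>, \<open>w\<close> with
  \<open>\<pi> w < \<pi> v\<close> can only be kept incomparable by the last coordinate.

  Functions satisfying the first condition are the functions on the horizontal classes, and for
  these the other two conditions say that \<open>h\<close> increases along the edges of the pre-Reeb graph and
  along the auxiliary edges. This is the bijection. A real-valued function that increases along
  all edges of a finite graph exists iff the graph is acyclic; counting the proper ancestors of a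
  vertex gives one.
\<close>

section \<open>Chains of covers\<close>

lemma cover_below:
  assumes "finite P" "x \<in> P" "y \<in> P" "x < y"
  obtains m where "covers P x m" "m \<le> y"
proof -
  let ?S = "{z \<in> P. x < z \<and> z \<le> y}"
  have "finite ?S" "?S \<noteq> {}" using assms by auto
  then obtain m where m: "m \<in> ?S" "\<And>z. z \<in> ?S \<Longrightarrow> z \<le> m \<Longrightarrow> m = z"
    using finite_has_minimal[of ?S] by auto
  have "covers P x m"
    unfolding covers_def
  proof (intro conjI notI)
    assume "\<exists>z\<in>P. x < z \<and> z < m"
    then obtain z where z: "z \<in> P" "x < z" "z < m" by blast
    then have "z \<le> y" using m(1) by (auto intro: less_imp_le less_le_trans)
    with z have "m = z" by (intro m(2)) auto
    with z(3) show False by simp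
  qed (use m(1) assms(2) in auto)
  with m(1) that show thesis by auto
qed

lemma mono_from_covers:
  fixes f :: "'a::order \<Rightarrow> 'b::preorder"
  assumes fin: "finite P" and step: "\<And>v w. covers P v w \<Longrightarrow> f v \<le> f w"
    and "x \<in> P" "y \<in> P" "x \<le> y"
  shows "f x \<le> f y"
  using assms(3-5)
proof (induction "card {z \<in> P. x \<le> z \<and> z \<le> y}" arbitrary: x rule: less_induct)
  case less
  show ?case
  proof (cases "x = y")
    case False
    with less.prems have "x < y" by auto
    then obtain m where m: "covers P x m" "m \<le> y"
      using cover_below[OF fin less.prems(1,2)] by blast
    then have xm: "x < m" "m \<in> P" by (auto simp: covers_def)
    have "{z \<in> P. m \<le> z \<and> z \<le> y} \<subset> {z \<in> P. x \<le> z \<and> z \<le> y}"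
    proof
      show "{z \<in> P. m \<le> z \<and> z \<le> y} \<subseteq> {z \<in> P. x \<le> z \<and> z \<le> y}"
        using xm(1) by (auto intro: less_imp_le less_le_trans)
      have "x \<in> {z \<in> P. x \<le> z \<and> z \<le> y}" "x \<notin> {z \<in> P. m \<le> z \<and> z \<le> y}"
        using less.prems xm by auto
      then show "{z \<in> P. m \<le> z \<and> z \<le> y} \<noteq> {z \<in> P. x \<le> z \<and> z \<le> y}" by blast
    qed
    then have "card {z \<in> P. m \<le> z \<and> z \<le> y} < card {z \<in> P. x \<le> z \<and> z \<le> y}"
      using fin by (intro psubset_card_mono) auto
    then have "f m \<le> f y" using less.hyps xm(2) less.prems(2) m(2) by blast
    with step[OF m(1)] show ?thesis by (rule order.trans)
  qed simp
qed

section \<open>Vectors with an added coordinate\<close>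

text \<open>The condition that a cubic realization imposes on the end points of a cover.\<close>

definition axis_step :: "nat \<Rightarrow> real vec \<Rightarrow> real vec \<Rightarrow> bool" where
  "axis_step d u v \<longleftrightarrow> (\<exists>i<d. u $ i < v $ i \<and> (\<forall>j<d. j \<noteq> i \<longrightarrow> u $ j = v $ j))"

lemma axis_step_irrefl: "\<not> axis_step d u u"
  by (auto simp: axis_step_def)

lemma add_coord_carrier:
  "u \<in> carrier_vec d \<Longrightarrow> add_coord u a \<in> carrier_vec (d + 1)"
  unfolding add_coord_def by (rule append_carrier_vec) auto

lemma add_coord_nth:
  assumes "u \<in> carrier_vec d"
  shows "i < d \<Longrightarrow> add_coord u a $ i = u $ i" "add_coord u a $ d = a"
  using assms by (auto simp: add_coord_def)

lemma add_coord_eq_iff: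
  assumes "u \<in> carrier_vec d" "v \<in> carrier_vec d"
  shows "add_coord u a = add_coord v b \<longleftrightarrow> u = v \<and> a = b"
proof
  assume eq: "add_coord u a = add_coord v b"
  show "u = v \<and> a = b"
  proof
    show "u = v"
      using assms add_coord_nth(1)[OF assms(1), of _ a] add_coord_nth(1)[OF assms(2), of _ b] eq
      by (intro eq_vecI) auto
    show "a = b"
      using add_coord_nth(2)[OF assms(1), of a] add_coord_nth(2)[OF assms(2), of b] eq by simp
  qed
qed simp

lemma add_coord_le_iff:
  assumes "u \<in> carrier_vec d" "v \<in> carrier_vec d"
  shows "add_coord u a \<le> add_coord v b \<longleftrightarrow> u \<le> v \<and> a \<le> b"
proof -
  have "add_coord u a \<le> add_coord v b \<longleftrightarrow>
      (\<forall>i<Suc d. add_coord u a $ i \<le> add_coord v b $ i)"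
    using add_coord_carrier[OF assms(1), of a] add_coord_carrier[OF assms(2), of b]
    by (auto simp: less_eq_vec_def)
  also have "\<dots> \<longleftrightarrow> u \<le> v \<and> a \<le> b"
    using assms by (auto simp: All_less_Suc less_eq_vec_def add_coord_nth)
  finally show ?thesis .
qed

text \<open>
  A step in one of the \<open>d + 1\<close> directions uses either the new direction or one of the old ones,
  and the coordinates of the other kind are then unchanged.
\<close>

lemma axis_step_add_coord_iff:
  assumes u: "u \<in> carrier_vec d" and v: "v \<in> carrier_vec d"
  shows "axis_step (d + 1) (add_coord u a) (add_coord v b) \<longleftrightarrow>
    u = v \<and> a < b \<or> axis_step d u v \<and> a = b"
proof -
  have eq: "u = v \<longleftrightarrow> (\<forall>i<d. u $ i = v $ i)"
    using u v by auto
  show ?thesis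
    unfolding axis_step_def eq Suc_eq_plus1[symmetric] All_less_Suc Ex_less_Suc
    by (auto simp: add_coord_nth[OF u] add_coord_nth[OF v])
qed

section \<open>Admissible height functions\<close>

lemma cubic_realization_iff:
  "cubic_realization P d c \<longleftrightarrow>
    c \<in> P \<rightarrow> carrier_vec d \<and> inj_on c P \<and> (\<forall>x y. covers P x y \<longrightarrow> axis_step d (c x) (c y))"
  by (simp add: cubic_realization_def axis_step_def)

lemma cubic_realization_cong:
  assumes "\<And>x. x \<in> P \<Longrightarrow> c x = c' x"
  shows "cubic_realization P d c \<longleftrightarrow> cubic_realization P d c'"
proof -
  have "c \<in> P \<rightarrow> carrier_vec d \<longleftrightarrow> c' \<in> P \<rightarrow> carrier_vec d" "inj_on c P \<longleftrightarrow> inj_on c' P"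
    using assms by (auto simp: Pi_def inj_on_def)
  moreover have "axis_step d (c x) (c y) \<longleftrightarrow> axis_step d (c' x) (c' y)" if "covers P x y" for x y
    using assms that by (simp add: covers_def)
  ultimately show ?thesis unfolding cubic_realization_iff by blast
qed

lemma order_embedding_on_cong:
  assumes "\<And>x. x \<in> P \<Longrightarrow> c x = c' x"
  shows "order_embedding_on P c \<longleftrightarrow> order_embedding_on P c'"
  using assms by (auto simp: order_embedding_on_def)

lemma order_embedding_on_inj: "order_embedding_on P c \<Longrightarrow> inj_on c P"
  by (rule inj_onI) (auto simp: order_embedding_on_def intro: order.antisym)

definition admissible_height ::
  "'p::order set \<Rightarrow> 'q::order set \<Rightarrow> ('p \<Rightarrow> 'q) \<Rightarrow> ('p \<Rightarrow> real) \<Rightarrow> bool" where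
  "admissible_height P Q \<pi> h \<longleftrightarrow>
    (\<forall>v w. horizontal_cover P Q \<pi> v w \<longrightarrow> h v = h w) \<and>
    (\<forall>v w. vertical_cover P \<pi> v w \<longrightarrow> h v < h w) \<and>
    (\<forall>v\<in>P. \<forall>w\<in>P. \<pi> w < \<pi> v \<and> \<not> v \<le> w \<and> \<not> w \<le> v \<longrightarrow> h v < h w)"

locale cylindrical_setting =
  fixes P :: "'p::order set" and Q :: "'q::order set"
    and \<pi> :: "'p \<Rightarrow> 'q" and d :: nat and c\<^sub>Q :: "'q \<Rightarrow> real vec"
  assumes finite_P: "finite P"
    and cyl: "cylindrical_projection P Q \<pi>"
    and cubic_Q: "cubic_realization Q d c\<^sub>Q"
    and oe_Q: "order_embedding_on Q c\<^sub>Q"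
begin

lemma proj_in: "x \<in> P \<Longrightarrow> \<pi> x \<in> Q"
  using cyl by (auto simp: cylindrical_projection_def)

lemma base_carrier: "x \<in> P \<Longrightarrow> c\<^sub>Q (\<pi> x) \<in> carrier_vec d"
  using cubic_Q proj_in by (auto simp: cubic_realization_def)

lemma cover_horizontal_or_vertical:
  "covers P v w \<Longrightarrow> horizontal_cover P Q \<pi> v w \<or> vertical_cover P \<pi> v w"
  using cyl by (auto simp: cylindrical_projection_def horizontal_cover_def vertical_cover_def)

lemma fiber_chain: "x \<in> P \<Longrightarrow> y \<in> P \<Longrightarrow> \<pi> x = \<pi> y \<Longrightarrow> x \<le> y \<or> y \<le> x"
  using cyl proj_in unfolding cylindrical_projection_def fiber_def by blast

lemma proj_mono: "x \<in> P \<Longrightarrow> y \<in> P \<Longrightarrow> x \<le> y \<Longrightarrow> \<pi> x \<le> \<pi> y"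
proof (rule mono_from_covers[OF finite_P])
  show "\<pi> v \<le> \<pi> w" if "covers P v w" for v w
    using cover_horizontal_or_vertical[OF that]
    by (auto simp: horizontal_cover_def vertical_cover_def covers_def[of Q])
qed

abbreviation lift :: "('p \<Rightarrow> real) \<Rightarrow> 'p \<Rightarrow> real vec" where
  "lift h x \<equiv> add_coord (c\<^sub>Q (\<pi> x)) (h x)"

lemma lift_le_iff:
  "x \<in> P \<Longrightarrow> y \<in> P \<Longrightarrow> lift h x \<le> lift h y \<longleftrightarrow> \<pi> x \<le> \<pi> y \<and> h x \<le> h y"
  using add_coord_le_iff[OF base_carrier base_carrier] oe_Q proj_in
  by (simp add: order_embedding_on_def)

lemma axis_step_lift_horizontal:
  assumes "horizontal_cover P Q \<pi> v w"
  shows "axis_step (d + 1) (lift h v) (lift h w) \<longleftrightarrow> h v = h w"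
proof -
  have vw: "v \<in> P" "w \<in> P" and cov: "covers Q (\<pi> v) (\<pi> w)"
    using assms by (auto simp: horizontal_cover_def covers_def)
  have "axis_step d (c\<^sub>Q (\<pi> v)) (c\<^sub>Q (\<pi> w))"
    using cubic_Q cov by (simp add: cubic_realization_iff)
  then show ?thesis
    using axis_step_add_coord_iff[OF base_carrier base_carrier, OF vw] axis_step_irrefl by auto
qed

lemma axis_step_lift_vertical:
  assumes "vertical_cover P \<pi> v w"
  shows "axis_step (d + 1) (lift h v) (lift h w) \<longleftrightarrow> h v < h w"
proof -
  have vw: "v \<in> P" "w \<in> P" "\<pi> v = \<pi> w"
    using assms by (auto simp: vertical_cover_def covers_def)
  then show ?thesis
    using axis_step_add_coord_iff[OF base_carrier base_carrier, OF vw(1,2)] axis_step_irrefl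
    by simp
qed

lemma admissible_height_mono:
  assumes "admissible_height P Q \<pi> h" "x \<in> P" "y \<in> P" "x \<le> y"
  shows "h x \<le> h y"
proof (rule mono_from_covers[OF finite_P _ assms(2-4)])
  show "h v \<le> h w" if "covers P v w" for v w
    using cover_horizontal_or_vertical[OF that] assms(1)
    by (auto simp: admissible_height_def intro: less_imp_le)
qed

text \<open>
  The first cover of a chain from \<open>x\<close> to \<open>y\<close> stays in the fiber because \<open>\<pi>\<close> is monotone, so it is
  vertical; the height increases strictly there and does not decrease afterwards.
\<close>

lemma admissible_height_strict_on_fiber:
  assumes adm: "admissible_height P Q \<pi> h"
    and xy: "x \<in> P" "y \<in> P" "x < y" "\<pi> x = \<pi> y"
  shows "h x < h y"
proof -
  obtain m where m: "covers P x m" "m \<le> y"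
    using cover_below[OF finite_P xy(1-3)] by blast
  then have mP: "m \<in> P" "x \<le> m" by (auto simp: covers_def)
  have "\<pi> x \<le> \<pi> m" "\<pi> m \<le> \<pi> y" using proj_mono mP m(2) xy by blast+
  with xy(4) have "\<pi> x = \<pi> m" by simp
  with m(1) have "vertical_cover P \<pi> x m" by (simp add: vertical_cover_def)
  with adm have "h x < h m" by (simp add: admissible_height_def)
  also have "h m \<le> h y" using admissible_height_mono[OF adm mP(1) xy(2) m(2)] .
  finally show ?thesis .
qed

text \<open>
  That the realization moves one coordinate per cover accounts for the two conditions on covers.
  That it reflects the order accounts for the condition on incomparable points \<open>v\<close>, \<open>w\<close> with
  \<open>\<pi> w < \<pi> v\<close>: the image of \<open>w\<close> lies below that of \<open>v\<close> in the first \<open>d\<close> coordinates, so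
  \<open>h w \<le> h v\<close> would force \<open>w \<le> v\<close>. Injectivity follows from the order embedding.
\<close>

lemma realization_iff_admissible_height:
  "cubic_realization P (d + 1) (lift h) \<and> order_embedding_on P (lift h) \<longleftrightarrow>
    admissible_height P Q \<pi> h"
proof
  assume L: "cubic_realization P (d + 1) (lift h) \<and> order_embedding_on P (lift h)"
  have step: "axis_step (d + 1) (lift h v) (lift h w)" if "covers P v w" for v w
    using L that unfolding cubic_realization_iff by blast
  have reflects: "x \<le> y" if "x \<in> P" "y \<in> P" "\<pi> x \<le> \<pi> y" "h x \<le> h y" for x y
    using L that lift_le_iff[OF that(1,2), of h] by (simp add: order_embedding_on_def)
  show "admissible_height P Q \<pi> h"
    unfolding admissible_height_def
  proof (intro conjI allI impI ballI)
    show "h v = h w" if "horizontal_cover P Q \<pi> v w" for v w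
      using axis_step_lift_horizontal[OF that] step[of v w] that
      by (simp add: horizontal_cover_def)
    show "h v < h w" if "vertical_cover P \<pi> v w" for v w
      using axis_step_lift_vertical[OF that] step[of v w] that
      by (simp add: vertical_cover_def)
    show "h v < h w"
      if "v \<in> P" "w \<in> P" "\<pi> w < \<pi> v \<and> \<not> v \<le> w \<and> \<not> w \<le> v" for v w
      using reflects[of w v] that by (meson less_imp_le not_le)
  qed
next
  assume adm: "admissible_height P Q \<pi> h"
  have oe: "order_embedding_on P (lift h)"
    unfolding order_embedding_on_def
  proof (intro ballI iffI)
    fix x y assume xy: "x \<in> P" "y \<in> P"
    show "lift h x \<le> lift h y" if "x \<le> y"
      using lift_le_iff[OF xy] proj_mono[OF xy that] admissible_height_mono[OF adm xy that]
      by blast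
    assume "lift h x \<le> lift h y"
    then have le: "\<pi> x \<le> \<pi> y" "h x \<le> h y" using lift_le_iff[OF xy] by auto
    show "x \<le> y"
    proof (cases "\<pi> x = \<pi> y")
      case True
      then have "\<not> y < x"
        using admissible_height_strict_on_fiber[OF adm xy(2,1)] le(2) by auto
      then show ?thesis using fiber_chain[OF xy True] by (auto simp: order.order_iff_strict)
    next
      case False
      then have lt: "\<pi> x < \<pi> y" using le(1) by simp
      then have "\<not> y \<le> x" using proj_mono[OF xy(2,1)] by auto
      then show ?thesis using adm xy lt le(2) unfolding admissible_height_def
        by (meson not_le)
    qed
  qed
  moreover have "lift h \<in> P \<rightarrow> carrier_vec (d + 1)"
    by (intro funcsetI add_coord_carrier base_carrier)
  moreover have "axis_step (d + 1) (lift h v) (lift h w)" if "covers P v w" for v w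
    using cover_horizontal_or_vertical[OF that]
  proof
    assume "horizontal_cover P Q \<pi> v w"
    then show ?thesis
      using axis_step_lift_horizontal[of v w h] adm unfolding admissible_height_def by blast
  next
    assume "vertical_cover P \<pi> v w"
    then show ?thesis
      using axis_step_lift_vertical[of v w h] adm unfolding admissible_height_def by blast
  qed
  ultimately show "cubic_realization P (d + 1) (lift h) \<and> order_embedding_on P (lift h)"
    unfolding cubic_realization_iff using order_embedding_on_inj[OF oe] by blast
qed

end

section \<open>Heights as labelings of the Reeb graph\<close>

lemma equiv_hor_rel: "equiv P (hor_rel P Q \<pi>)"
proof (rule equivI)
  show "hor_rel P Q \<pi> \<subseteq> P \<times> P" by (auto simp: hor_rel_def)
  show "refl_on P (hor_rel P Q \<pi>)" by (auto simp: refl_on_def hor_rel_def)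
  show "sym (hor_rel P Q \<pi>)" 
    unfolding sym_def hor_rel_def by (blast intro: equivclp_sym)
  show "trans (hor_rel P Q \<pi>)" 
    unfolding trans_def hor_rel_def by (blast intro: equivclp_trans)
qed

lemma hor_class_vertex: "v \<in> P \<Longrightarrow> hor_class P Q \<pi> v \<in> reeb_vertices P Q \<pi>"
  by (simp add: hor_class_def reeb_vertices_def quotientI)

lemma hor_class_self: "v \<in> P \<Longrightarrow> v \<in> hor_class P Q \<pi> v"
  unfolding hor_class_def by (rule equiv_class_self[OF equiv_hor_rel])

lemma vertex_eq_hor_class:
  assumes "V \<in> reeb_vertices P Q \<pi>" "v \<in> V"
  shows "v \<in> P" "V = hor_class P Q \<pi> v"
proof -
  obtain u where u: "V = hor_rel P Q \<pi> `` {u}"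
    using assms(1) by (auto simp: reeb_vertices_def elim: quotientE)
  with assms(2) have uv: "(u, v) \<in> hor_rel P Q \<pi>" by simp
  then show "v \<in> P" by (simp add: hor_rel_def)
  show "V = hor_class P Q \<pi> v"
    unfolding u hor_class_def by (rule equiv_class_eq[OF equiv_hor_rel uv])
qed

lemma vertexE:
  assumes "V \<in> reeb_vertices P Q \<pi>"
  obtains v where "v \<in> P" "V = hor_class P Q \<pi> v"
  using assms that unfolding reeb_vertices_def hor_class_def by (blast elim: quotientE)

lemma hor_class_horizontal_cover:
  assumes "horizontal_cover P Q \<pi> v w"
  shows "hor_class P Q \<pi> v = hor_class P Q \<pi> w"
  unfolding hor_class_def
  by (rule equiv_class_eq[OF equiv_hor_rel])
    (use assms in \<open>auto simp: hor_rel_def horizontal_cover_def covers_def\<close>)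

lemma admissible_height_const_on_class:
  assumes "admissible_height P Q \<pi> h" "u \<in> hor_class P Q \<pi> v"
  shows "h u = h v"
proof -
  have "equivclp (horizontal_cover P Q \<pi>) v u"
    using assms(2) by (simp add: hor_class_def hor_rel_def)
  then show ?thesis
    by (induction rule: equivclp_induct)
      (use assms(1) in \<open>auto simp: admissible_height_def\<close>)
qed

lemma aug_reeb_edges_iff:
  "(V, W) \<in> aug_reeb_edges P Q \<pi> \<longleftrightarrow>
    (\<exists>v\<in>P. \<exists>w\<in>P. V = hor_class P Q \<pi> v \<and> W = hor_class P Q \<pi> w \<and>
      (vertical_cover P \<pi> v w \<or> \<pi> w < \<pi> v \<and> \<not> v \<le> w \<and> \<not> w \<le> v))"
  (is "?L \<longleftrightarrow> ?R")
proof
  assume ?L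
  then obtain v w where "V \<in> reeb_vertices P Q \<pi>" "W \<in> reeb_vertices P Q \<pi>" "v \<in> V" "w \<in> W"
    "vertical_cover P \<pi> v w \<or> \<pi> w < \<pi> v \<and> \<not> v \<le> w \<and> \<not> w \<le> v"
    by (auto simp: aug_reeb_edges_def pre_reeb_edges_def aux_reeb_edges_def)
  then show ?R using vertex_eq_hor_class[of V P Q \<pi> v] vertex_eq_hor_class[of W P Q \<pi> w] by blast
next
  assume ?R
  then show ?L
    unfolding aug_reeb_edges_def pre_reeb_edges_def aux_reeb_edges_def
    using hor_class_self[of _ P Q \<pi>] hor_class_vertex[of _ P Q \<pi>] by blast
qed

text \<open>
  A height that comes from a labeling of the classes is automatically constant along horizontal
  covers; the remaining two conditions are indexed by the two kinds of edges.
\<close>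

lemma increasing_iff_admissible_height:
  "(\<forall>(V, W) \<in> aug_reeb_edges P Q \<pi>. k V < k W) \<longleftrightarrow>
    admissible_height P Q \<pi> (\<lambda>x. k (hor_class P Q \<pi> x))"
proof -
  have vP: "v \<in> P \<and> w \<in> P" if "vertical_cover P \<pi> v w" for v w
    using that by (auto simp: vertical_cover_def covers_def)
  have "(\<forall>(V, W) \<in> aug_reeb_edges P Q \<pi>. k V < k W) \<longleftrightarrow>
    (\<forall>v\<in>P. \<forall>w\<in>P. vertical_cover P \<pi> v w \<or> \<pi> w < \<pi> v \<and> \<not> v \<le> w \<and> \<not> w \<le> v \<longrightarrow>
      k (hor_class P Q \<pi> v) < k (hor_class P Q \<pi> w))"
    unfolding Ball_def split_paired_All case_prod_conv aug_reeb_edges_iff by blast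
  also have "\<dots> \<longleftrightarrow> admissible_height P Q \<pi> (\<lambda>x. k (hor_class P Q \<pi> x))"
    unfolding admissible_height_def
    using vP hor_class_horizontal_cover[of P Q \<pi>, THEN arg_cong[of _ _ k]] by blast
  finally show ?thesis .
qed

text \<open>
  Conversely, every admissible height descends to the classes: it may be read off at any
  representative, since it is constant on each class.
\<close>

lemma admissible_height_factors:
  assumes "admissible_height P Q \<pi> h"
  obtains k where "k \<in> increasing_labelings P Q \<pi>"
    "\<And>x. x \<in> P \<Longrightarrow> k (hor_class P Q \<pi> x) = h x"
proof -
  define k where "k = (\<lambda>V\<in>reeb_vertices P Q \<pi>. h (SOME v. v \<in> V))"
  have k: "k (hor_class P Q \<pi> x) = h x" if "x \<in> P" for x
  proof -
    have "(SOME v. v \<in> hor_class P Q \<pi> x) \<in> hor_class P Q \<pi> x"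
      using hor_class_self[OF that] by (rule someI)
    then show ?thesis
      using admissible_height_const_on_class[OF assms] hor_class_vertex[OF that, of Q \<pi>]
      by (simp add: k_def)
  qed
  have "admissible_height P Q \<pi> (\<lambda>x. k (hor_class P Q \<pi> x))"
    using assms k
    by (auto simp: admissible_height_def horizontal_cover_def vertical_cover_def covers_def)
  then have "k \<in> increasing_labelings P Q \<pi>"
    using increasing_iff_admissible_height[of P Q \<pi> k]
    by (auto simp: increasing_labelings_def k_def)
  with k that show thesis by blast
qed

text \<open>
  A labeling is recovered from its realization as the last coordinate at a representative of each
  class. Every compatible realization is the lift of a height, which is admissible and hence
  factors through the classes.
\<close>

lemma (in cylindrical_setting) bij_labelings_realizations:
  "bij_betw (\<lambda>k. \<lambda>x\<in>P. lift (\<lambda>x. k (hor_class P Q \<pi> x)) x)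
    (increasing_labelings P Q \<pi>) (compatible_oe_realizations P d \<pi> c\<^sub>Q)"
  (is "bij_betw ?F ?L ?C")
proof (rule bij_betw_imageI)
  show "inj_on ?F ?L"
  proof (rule inj_onI)
    fix k k' assume kk: "k \<in> ?L" "k' \<in> ?L" and eq: "?F k = ?F k'"
    show "k = k'"
    proof (rule PiE_ext)
      show "k \<in> reeb_vertices P Q \<pi> \<rightarrow>\<^sub>E UNIV" "k' \<in> reeb_vertices P Q \<pi> \<rightarrow>\<^sub>E UNIV"
        using kk by (auto simp: increasing_labelings_def)
      fix V assume "V \<in> reeb_vertices P Q \<pi>"
      then obtain v where v: "v \<in> P" "V = hor_class P Q \<pi> v" by (rule vertexE)
      have "add_coord (c\<^sub>Q (\<pi> v)) (k V) = add_coord (c\<^sub>Q (\<pi> v)) (k' V)"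
        using fun_cong[OF eq, of v] v by simp
      then show "k V = k' V"
        using add_coord_eq_iff[OF base_carrier base_carrier, OF v(1) v(1)] by blast
    qed
  qed
  show "?F ` ?L = ?C"
  proof
    show "?F ` ?L \<subseteq> ?C"
    proof
      fix c assume "c \<in> ?F ` ?L"
      then obtain k where k: "k \<in> ?L" "c = ?F k" by blast
      let ?h = "\<lambda>x. k (hor_class P Q \<pi> x)"
      have "admissible_height P Q \<pi> ?h"
        using k(1) increasing_iff_admissible_height[of P Q \<pi> k]
        by (simp add: increasing_labelings_def)
      then have "cubic_realization P (d + 1) (lift ?h)" "order_embedding_on P (lift ?h)"
        using realization_iff_admissible_height[of ?h] by auto
      moreover have c: "c x = lift ?h x" if "x \<in> P" for x using that k(2) by simp
      ultimately have "cubic_realization P (d + 1) c" "order_embedding_on P c"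
        using cubic_realization_cong[of P c "lift ?h"] order_embedding_on_cong[of P c "lift ?h"]
        by auto
      moreover have "compatible P \<pi> c\<^sub>Q c"
        unfolding compatible_def using c by (intro exI[of _ ?h]) blast
      moreover have "c \<in> P \<rightarrow>\<^sub>E carrier_vec (d + 1)"
        unfolding k(2) using add_coord_carrier[OF base_carrier] by auto
      ultimately show "c \<in> ?C" by (simp add: compatible_oe_realizations_def)
    qed
    show "?C \<subseteq> ?F ` ?L"
    proof
      fix c assume c: "c \<in> ?C"
      then obtain h where h: "\<And>x. x \<in> P \<Longrightarrow> c x = lift h x"
        by (auto simp: compatible_oe_realizations_def compatible_def)
      have "cubic_realization P (d + 1) (lift h)" "order_embedding_on P (lift h)"
        using c cubic_realization_cong[of P c "lift h"] order_embedding_on_cong[of P c "lift h"] h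
        by (auto simp: compatible_oe_realizations_def)
      then have "admissible_height P Q \<pi> h"
        using realization_iff_admissible_height[of h] by blast
      then obtain k where k: "k \<in> ?L" "\<And>x. x \<in> P \<Longrightarrow> k (hor_class P Q \<pi> x) = h x"
        by (rule admissible_height_factors) blast
      have "c = ?F k"
      proof (rule PiE_ext)
        show "c \<in> P \<rightarrow>\<^sub>E UNIV" using c by (auto simp: compatible_oe_realizations_def)
        show "?F k \<in> P \<rightarrow>\<^sub>E UNIV" by simp
        show "c x = ?F k x" if "x \<in> P" for x using that h k(2) by simp
      qed
      with k(1) show "c \<in> ?F ` ?L" by blast
    qed
  qed
qed

section \<open>Existence and acyclicity\<close>

text \<open>Along a directed cycle a strictly increasing function would exceed itself.\<close>

lemma acyclic_of_increasing:
  fixes k :: "'a \<Rightarrow> 'b::order"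
  assumes "\<And>x y. (x, y) \<in> E \<Longrightarrow> k x < k y"
  shows "acyclic E"
proof -
  have "k x < k y" if "(x, y) \<in> E\<^sup>+" for x y
    using that by induction (use assms in \<open>auto intro: less_trans\<close>)
  then show ?thesis unfolding acyclic_def by blast
qed

text \<open>
  The number of proper ancestors increases along an edge \<open>(x, y)\<close>: those of \<open>x\<close> are also ancestors
  of \<open>y\<close>, and \<open>x\<close> is a further one because there are no cycles.
\<close>

lemma acyclic_imp_increasing:
  assumes fin: "finite E" and acyc: "acyclic E" and xy: "(x, y) \<in> E"
  shows "card {u. (u, x) \<in> E\<^sup>+} < card {u. (u, y) \<in> E\<^sup>+}"
proof (rule psubset_card_mono)
  have "{u. (u, y) \<in> E\<^sup>+} \<subseteq> Domain (E\<^sup>+)" by blast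
  then show "finite {u. (u, y) \<in> E\<^sup>+}"
    by (rule finite_subset) (simp add: trancl_domain finite_Domain fin)
  have "x \<in> {u. (u, y) \<in> E\<^sup>+}" "x \<notin> {u. (u, x) \<in> E\<^sup>+}"
    using xy acyc by (auto simp: acyclic_def)
  moreover have "{u. (u, x) \<in> E\<^sup>+} \<subseteq> {u. (u, y) \<in> E\<^sup>+}"
    using xy by (auto intro: trancl_into_trancl)
  ultimately show "{u. (u, x) \<in> E\<^sup>+} \<subset> {u. (u, y) \<in> E\<^sup>+}" by blast
qed

lemma finite_aug_reeb_edges:
  assumes "finite P"
  shows "finite (aug_reeb_edges P Q \<pi>)"
proof (rule finite_subset)
  show "aug_reeb_edges P Q \<pi> \<subseteq> reeb_vertices P Q \<pi> \<times> reeb_vertices P Q \<pi>"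
    by (auto simp: aug_reeb_edges_def pre_reeb_edges_def aux_reeb_edges_def)
  have "finite (reeb_vertices P Q \<pi>)"
    unfolding reeb_vertices_def
    by (rule finite_quotient[OF assms]) (auto simp: hor_rel_def)
  then show "finite (reeb_vertices P Q \<pi> \<times> reeb_vertices P Q \<pi>)" by simp
qed

lemma increasing_labelings_nonempty_iff:
  assumes "finite P"
  shows "increasing_labelings P Q \<pi> \<noteq> {} \<longleftrightarrow> acyclic (aug_reeb_edges P Q \<pi>)"
    (is "_ \<longleftrightarrow> acyclic ?E")
proof
  assume "increasing_labelings P Q \<pi> \<noteq> {}"
  then obtain k where "\<And>V W. (V, W) \<in> ?E \<Longrightarrow> k V < (k W :: real)"
    by (fastforce simp: increasing_labelings_def)
  then show "acyclic ?E" by (rule acyclic_of_increasing)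
next
  assume acyc: "acyclic ?E"
  define k where "k = (\<lambda>V\<in>reeb_vertices P Q \<pi>. real (card {U. (U, V) \<in> ?E\<^sup>+}))"
  have "k V < k W" if "(V, W) \<in> ?E" for V W
  proof -
    have "V \<in> reeb_vertices P Q \<pi>" "W \<in> reeb_vertices P Q \<pi>"
      using that by (auto simp: aug_reeb_edges_def pre_reeb_edges_def aux_reeb_edges_def)
    then show ?thesis
      using acyclic_imp_increasing[OF finite_aug_reeb_edges[OF assms] acyc that]
      by (simp add: k_def)
  qed
  moreover have "k \<in> reeb_vertices P Q \<pi> \<rightarrow>\<^sub>E UNIV"
    by (simp add: k_def)
  ultimately have "k \<in> increasing_labelings P Q \<pi>"
    by (auto simp: increasing_labelings_def)
  then show "increasing_labelings P Q \<pi> \<noteq> {}" by blast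
qed

lemma compatible_oe_realizations_nonempty_iff:
  "compatible_oe_realizations P d \<pi> c\<^sub>Q \<noteq> {} \<longleftrightarrow>
    (\<exists>c. cubic_realization P (d + 1) c \<and> order_embedding_on P c \<and> compatible P \<pi> c\<^sub>Q c)"
proof
  assume "\<exists>c. cubic_realization P (d + 1) c \<and> order_embedding_on P c \<and> compatible P \<pi> c\<^sub>Q c"
  then obtain c where c: "cubic_realization P (d + 1) c" "order_embedding_on P c"
    "compatible P \<pi> c\<^sub>Q c" by blast
  have "restrict c P \<in> P \<rightarrow>\<^sub>E carrier_vec (d + 1)"
    using c(1) by (auto simp: cubic_realization_def)
  moreover have "cubic_realization P (d + 1) (restrict c P)" "order_embedding_on P (restrict c P)"
    using c cubic_realization_cong[of P c "restrict c P"]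
      order_embedding_on_cong[of P c "restrict c P"] by auto
  moreover have "compatible P \<pi> c\<^sub>Q (restrict c P)"
    using c(3) by (auto simp: compatible_def)
  ultimately show "compatible_oe_realizations P d \<pi> c\<^sub>Q \<noteq> {}"
    unfolding compatible_oe_realizations_def by blast
qed (auto simp: compatible_oe_realizations_def)

theorem proposition1p11:
  fixes P :: "'p::order set" and Q :: "'q::order set"
    and \<pi> :: "'p \<Rightarrow> 'q" and d :: nat and c\<^sub>Q :: "'q \<Rightarrow> real vec"
  assumes "finite P" and "finite Q"
    and "cylindrical_projection P Q \<pi>"
    and "cubic_realization Q d c\<^sub>Q" and "order_embedding_on Q c\<^sub>Q"
  shows "bij_betw (\<lambda>h. \<lambda>x\<in>P. add_coord (c\<^sub>Q (\<pi> x)) (h (hor_class P Q \<pi> x)))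
           (increasing_labelings P Q \<pi>) (compatible_oe_realizations P d \<pi> c\<^sub>Q)
       \<and> ((\<exists>c\<^sub>P. cubic_realization P (d + 1) c\<^sub>P \<and> order_embedding_on P c\<^sub>P \<and> compatible P \<pi> c\<^sub>Q c\<^sub>P)
           \<longleftrightarrow> acyclic (aug_reeb_edges P Q \<pi>))"
proof -
  interpret cylindrical_setting P Q \<pi> d c\<^sub>Q
    using assms by unfold_locales
  have "compatible_oe_realizations P d \<pi> c\<^sub>Q \<noteq> {} \<longleftrightarrow> increasing_labelings P Q \<pi> \<noteq> {}"
    using bij_labelings_realizations by (auto simp: bij_betw_def)
  then show ?thesis
    using bij_labelings_realizations
    unfolding increasing_labelings_nonempty_iff[OF assms(1)]
      compatible_oe_realizations_nonempty_iff by (intro conjI)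
qed

end
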